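(* Let $(V,E)$ be a simple directed graph structure with $V=\{1,\dots,n\}$, let $d_i:=|\mathcal{N}(i)|$ for $i=1,\dots,n$, and let $A\in\mathbb{R}^{n\times n}$. The row-wise Active Set Algorithm (described in the context) solves the problem $$\min_{L\in\mathbb{R}^{n\times n}}\ \|A-L\|_{\mathrm F}^2\quad\text{subject to } L\in\mathcal{L}_{sd}(V,E)$$ with $O\left(\sum_{i=1}^n d_i^2\right)$ time.
   Context: $E\subseteq V\times V$ is a set of directed edges; $\{i,j\}$ denotes the directed edge from $i$ to $j$; simple means that there are no self-loops ($\{i,i\}\notin E$ for all $i$) and no multiedges. $\mathcal{N}(i):=\{j\in V\mid \{i,j\}\in E,\ i\ne j\}$, with elements listed as $\mathcal{N}(i)_1,\dots,\mathcal{N}(i)_{d_i}$. $\mathcal{L}_{sd}(V,E)$ is the set of $L\in\mathbb{R}^{n\times n}$ with $L_{ii}\ge0$ for all $i$; $L_{ij}\le 0$ for $i\neq j$, $\{i,j\}\in E$; $L_{ij}=0$ for $i\ne j$, $\{i,j\}\notin E$; and $L\mathbf{1}_n=\mathbf{0}_n$, where $\mathbf{1}_n$ and $\mathbf{0}_n$ are the all-ones and zero vectors. $\|\cdot\|_{\mathrm F}$ is the Frobenius norm. $Q_m:=2\mathrm{I}_m+2\mathrm{J}_m$ with $\mathrm{I}_m$ the $m\times m$ identity and $\mathrm{J}_m$ the $m\times m$ all-ones matrix; $Q_m^{-1}=\frac12\left(\mathrm{I}_m-\frac1{1+m}\mathrm{J}_m\right)$, so that a product $Q_m^{-1}v$ can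 be calculated in $O(m)$ time. For an index set $F$, $b_F$ is the subvector of $b$ with indices in $F$, and vectors in $\mathbb{R}^{|F|}$ are indexed by $F$. Row-wise Active Set Algorithm (input: $A$ and the neighbor sets $\mathcal{N}(i)$, $i=1,\dots,n$): start with $L^\ast=\mathbf{0}_{n\times n}$. For each $i=1,\dots,n$: 1. Set $d:=|\mathcal{N}(i)|$, $B_1:=\emptyset$, $F_0:=\emptyset$, $F_1:=\{1,\dots,d\}$, $k:=1$, $x:=\mathbf{0}_d$, $b:=[2A_{ii}-2A_{i\mathcal{N}(i)_1},\dots,2A_{ii}-2A_{i\mathcal{N}(i)_d}]^\top$. 2. While $|F_{k-1}|\neq|F_k|$: set $y:=-Q_{|F_k|}^{-1}b_{F_k}$; set $B_{k+1}:=B_k\cup\{j\in F_k: y_j>0\}$ and $F_{k+1}:=F_k\setminus\{j\in F_k:y_j>0\}$; replace $k$ by $k+1$. 3. Set $x_{F_k}:=y$ (the last computed $y$); set $L^\ast_{i\mathcal{N}(i)_q}:=x_q$ for $q=1,\dots,d$ and $L^\ast_{ii}:=-\mathbf{1}^\top x$. Output $L^\ast$.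
   Formalization: The time counts real arithmetic, comparisons, entry accesses and set operations, but not initialising the n×n zero matrix nor the constant control work per row; with these counted the bound fails, e.g. for E empty, where the sum of d_i^2 is 0. *)

theory Defs
  imports "Jordan_Normal_Form.Matrix" "HOL-Library.Monad_Syntax"
begin

section \<open>The projection problem\<close>

text \<open>The vertex set is \<open>{0, \<dots>, n - 1}\<close> rather than \<open>{1, \<dots>, n}\<close>, in accordance with the
  indexing of \<^typ>\<open>real mat\<close>.\<close>

definition simple_digraph :: "nat \<Rightarrow> (nat \<times> nat) set \<Rightarrow> bool" where
  "simple_digraph n E \<longleftrightarrow> E \<subseteq> {..<n} \<times> {..<n} \<and> (\<forall>i. (i, i) \<notin> E)"

definition neighbors :: "(nat \<times> nat) set \<Rightarrow> nat \<Rightarrow> nat set" where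
  "neighbors E i = {j. (i, j) \<in> E \<and> i \<noteq> j}"

definition L_sd :: "nat \<Rightarrow> (nat \<times> nat) set \<Rightarrow> real mat set" where
  "L_sd n E = {L \<in> carrier_mat n n.
     (\<forall>i<n. L $$ (i, i) \<ge> 0) \<and>
     (\<forall>i<n. \<forall>j<n. i \<noteq> j \<and> (i, j) \<in> E \<longrightarrow> L $$ (i, j) \<le> 0) \<and>
     (\<forall>i<n. \<forall>j<n. i \<noteq> j \<and> (i, j) \<notin> E \<longrightarrow> L $$ (i, j) = 0) \<and>
     L *\<^sub>v vec n (\<lambda>_. 1) = 0\<^sub>v n}"

definition frobenius_norm :: "real mat \<Rightarrow> real" where
  "frobenius_norm M = sqrt (\<Sum>i<dim_row M. \<Sum>j<dim_col M. (M $$ (i, j))\<^sup>2)"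


section \<open>Computations with a step count\<close>

text \<open>A computation either diverges (\<^const>\<open>None\<close>) or delivers a result together with the number of
  elementary steps performed. The machine is the unit-cost real RAM. One step each is charged for

  \<^item> a real addition, subtraction, multiplication, division, negation or comparison;
  \<^item> reading an entry of an input or of an array, and writing an entry of an array;
  \<^item> each element visited when the cardinality of an index set is determined.

  Arrays and index sets are represented by lists; appending is the writing of the next entry, and
  \<open>xs ! j\<close> and \<open>xs[j := v]\<close> are random accesses. What is not charged is allocating the zero matrix
  and the constant number of scalar operations (control of the loop over the rows, initialising an
  empty set, and so on) that occur once per row even if the row has no neighbours. No bound in terms of
  the \<open>d\<^sub>i\<close> alone could absorb these, since all \<open>d\<^sub>i\<close> may vanish; in a row with \<open>d\<^sub>i \<ge> 1\<close> they
  are dominated by what is charged.\<close>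

type_synonym 'a comp = "('a \<times> nat) option"

definition charge :: "nat \<Rightarrow> 'a \<Rightarrow> 'a comp" where
  "charge t a = Some (a, t)"

definition bind_comp :: "'a comp \<Rightarrow> ('a \<Rightarrow> 'b comp) \<Rightarrow> 'b comp" where
  "bind_comp m f =
     Option.bind m (\<lambda>(a, s). Option.bind (f a) (\<lambda>(b, t). Some (b, s + t)))"

no_adhoc_overloading Monad_Syntax.bind \<rightleftharpoons> Option.bind
adhoc_overloading Monad_Syntax.bind \<rightleftharpoons> bind_comp

lemma bind_comp_mono [partial_function_mono]:
  assumes "mono_option m" and "\<And>a. mono_option (\<lambda>f. g a f)"
  shows "mono_option (\<lambda>f. bind_comp (m f) (\<lambda>a. g a f))"
  unfolding bind_comp_def case_prod_unfold
  by (intro bind_mono assms option.const_mono)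

fun for_each :: "'a list \<Rightarrow> ('a \<Rightarrow> 's \<Rightarrow> 's comp) \<Rightarrow> 's \<Rightarrow> 's comp" where
  "for_each [] f s = charge 0 s"
| "for_each (a # as) f s = do { s' \<leftarrow> f a s; for_each as f s' }"

partial_function (option) while_loop ::
  "('s \<Rightarrow> bool comp) \<Rightarrow> ('s \<Rightarrow> 's comp) \<Rightarrow> 's \<Rightarrow> 's comp" where
  "while_loop g f s =
     do { b \<leftarrow> g s; if b then do { s' \<leftarrow> f s; while_loop g f s' } else charge 0 s }"

lemma for_each_sum:
  "for_each v (\<lambda>a s. charge k (s + a)) s0 = Some (s0 + sum_list v, k * length v)"
  for v :: "real list"
  by (induction v arbitrary: s0) (auto simp: charge_def bind_comp_def)

lemma for_each_append:
  "for_each v (\<lambda>a w. charge k (w @ [f a])) w0 = Some (w0 @ map f v, k * length v)"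
  by (induction v arbitrary: w0) (auto simp: charge_def bind_comp_def)

lemma charge_bind: "bind_comp (charge t a) f = map_option (\<lambda>(b, s). (b, t + s)) (f a)"
  by (cases "f a") (auto simp: charge_def bind_comp_def)

lemma Some_bind: "bind_comp (Some (a, t)) f = map_option (\<lambda>(b, s). (b, t + s)) (f a)"
  by (cases "f a") (auto simp: bind_comp_def)


section \<open>The matrix Q and the product with its inverse\<close>

definition Q_mat :: "nat \<Rightarrow> real mat" where
  "Q_mat m = 2 \<cdot>\<^sub>m 1\<^sub>m m + 2 \<cdot>\<^sub>m mat m m (\<lambda>_. 1)"

definition Q_inv :: "nat \<Rightarrow> real mat" where
  "Q_inv m = (1 / 2) \<cdot>\<^sub>m (1\<^sub>m m - (1 / (1 + real m)) \<cdot>\<^sub>m mat m m (\<lambda>_. 1))"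

definition mult_Q_inv :: "real list \<Rightarrow> real list comp" where
  "mult_Q_inv v = do {
     s \<leftarrow> for_each v (\<lambda>a s. charge 2 (s + a)) 0;
     m \<leftarrow> charge (length v) (length v);
     c \<leftarrow> charge 2 (s / (1 + real m));
     for_each v (\<lambda>a w. charge 4 (w @ [(a - c) / 2])) []
   }"

lemma Q_mat_Q_inv: "Q_mat m * Q_inv m = 1\<^sub>m m" "Q_inv m * Q_mat m = 1\<^sub>m m"
proof -
  define r where "r = 1 / (1 + real m)"
  have r: "r + real m * r = 1" by (simp add: r_def field_simps)
  have key: "(\<Sum>k = 0..<m. (2 * (if k = i then 1 else 0) + 2) *
      (((if k = j then 1 else 0) - r) / 2)) = (if i = j then 1 else 0)" (is "?S = _")
    if "i < m" "j < m" for i j :: nat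
  proof -
    have "?S = (\<Sum>k = 0..<m. (if k = i then (if k = j then 1 else 0) - r else 0)
        + (if k = j then 1 else 0) - r)"
      by (rule sum.cong) (auto simp: field_simps)
    also have "\<dots> = (if i = j then 1 else 0) + (1 - r - real m * r)"
      using that by (simp add: sum.distrib sum_subtractf)
    finally show ?thesis using r by simp
  qed
  have key': "(\<Sum>k = 0..<m. ((if k = i then 1 else 0) - r) / 2 *
      (2 * (if k = j then 1 else 0) + 2)) = (if i = j then 1 else 0)"
    if "i < m" "j < m" for i j :: nat
  proof -
    have "(\<Sum>k = 0..<m. ((if k = i then 1 else 0) - r) / 2 * (2 * (if k = j then 1 else 0) + 2)) =
        (\<Sum>k = 0..<m. (2 * (if k = j then 1 else 0) + 2) * (((if k = i then 1 else 0) - r) / 2))"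
      by (rule sum.cong[OF refl], rule mult.commute)
    also have "\<dots> = (if j = i then 1 else 0)"
      by (rule key[OF that(2,1)])
    finally show ?thesis
      unfolding eq_commute[of j i] .
  qed
  have Q: "Q_mat m \<in> carrier_mat m m"
    "i < m \<Longrightarrow> j < m \<Longrightarrow> Q_mat m $$ (i, j) = 2 * (if j = i then 1 else 0) + 2"
    "i < m \<Longrightarrow> j < m \<Longrightarrow> Q_mat m $$ (i, j) = 2 * (if i = j then 1 else 0) + 2" for i j
    by (auto simp: Q_mat_def)
  have Q': "Q_inv m \<in> carrier_mat m m"
    "i < m \<Longrightarrow> j < m \<Longrightarrow> Q_inv m $$ (i, j) = ((if j = i then 1 else 0) - r) / 2"
    "i < m \<Longrightarrow> j < m \<Longrightarrow> Q_inv m $$ (i, j) = ((if i = j then 1 else 0) - r) / 2" for i j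
    by (auto simp: Q_inv_def r_def)
  show "Q_mat m * Q_inv m = 1\<^sub>m m"
  proof (rule eq_matI, goal_cases)
    case (1 i j)
    then have ij: "i < m" "j < m" by auto
    have "(Q_mat m * Q_inv m) $$ (i, j) = (\<Sum>k = 0..<m. Q_mat m $$ (i, k) * Q_inv m $$ (k, j))"
      using ij Q(1) Q'(1) by (simp add: scalar_prod_def)
    also have "\<dots> = (if i = j then 1 else 0)"
      unfolding key[OF ij, symmetric] by (rule sum.cong) (simp_all only: Q(2) Q'(3) ij atLeastLessThan_iff)
    finally show ?case using ij by simp
  qed (use Q(1) Q'(1) in auto)
  show "Q_inv m * Q_mat m = 1\<^sub>m m"
  proof (rule eq_matI, goal_cases)
    case (1 i j)
    then have ij: "i < m" "j < m" by auto
    have "(Q_inv m * Q_mat m) $$ (i, j) = (\<Sum>k = 0..<m. Q_inv m $$ (i, k) * Q_mat m $$ (k, j))"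
      using ij Q(1) Q'(1) by (simp add: scalar_prod_def)
    also have "\<dots> = (if i = j then 1 else 0)"
      unfolding key'[OF ij, symmetric] by (rule sum.cong) (simp_all only: Q(3) Q'(2) ij atLeastLessThan_iff)
    finally show ?case using ij by simp
  qed (use Q(1) Q'(1) in auto)
qed

lemma mult_Q_inv_correct:
  "\<exists>w. mult_Q_inv v = Some (w, 7 * length v + 2) \<and>
       vec_of_list w = Q_inv (length v) *\<^sub>v vec_of_list v"
proof -
  define c where "c = sum_list v / (1 + real (length v))"
  have "mult_Q_inv v = Some (map (\<lambda>a. (a - c) / 2) v, 7 * length v + 2)"
    unfolding mult_Q_inv_def for_each_sum for_each_append charge_bind Some_bind c_def
    by simp
  moreover have "vec_of_list (map (\<lambda>a. (a - c) / 2) v) = Q_inv (length v) *\<^sub>v vec_of_list v"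
  proof (rule eq_vecI, goal_cases)
    case (1 i)
    then have i: "i < length v" by (simp add: Q_inv_def)
    have s: "sum_list v = (\<Sum>k = 0..<length v. v ! k)"
      by (simp add: sum_list_sum_nth)
    have "(Q_inv (length v) *\<^sub>v vec_of_list v) $ i =
       (\<Sum>k = 0..<length v. ((if i = k then 1 else 0) - 1 / (1 + real (length v))) / 2 * v ! k)"
      using i by (simp add: Q_inv_def scalar_prod_def vec_of_list_index)
    also have "\<dots> = (\<Sum>k = 0..<length v. (if i = k then v ! k / 2 else 0) -
        v ! k * (1 / (2 * (1 + real (length v)))))"
      by (rule sum.cong) (auto simp: field_simps)
    also have "\<dots> = v ! i / 2 - sum_list v * (1 / (2 * (1 + real (length v))))"
      using i by (simp add: sum_subtractf s sum_divide_distrib)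
    finally show ?case using i by (simp add: c_def vec_of_list_index field_simps)
  qed (simp add: Q_inv_def)
  ultimately show ?thesis by blast
qed


section \<open>The row-wise active set algorithm\<close>

text \<open>A vector indexed by an index set \<open>F\<close> is stored as a list parallel to the list of the elements
  of \<open>F\<close>. Indices into \<open>{1, \<dots>, d}\<close> start at 0.\<close>

definition subvector :: "real list \<Rightarrow> nat list \<Rightarrow> real list comp" where
  "subvector b F = for_each F (\<lambda>j v. charge 3 (v @ [b ! j])) []"

definition negate :: "real list \<Rightarrow> real list comp" where
  "negate w = for_each w (\<lambda>a y. charge 3 (y @ [- a])) []"

text \<open>Appends to \<open>B\<close> the \<open>j \<in> F\<close> with \<open>y\<^sub>j > 0\<close>, and collects the remaining ones.\<close>

definition split_active ::
  "nat list \<Rightarrow> real list \<Rightarrow> nat list \<Rightarrow> (nat list \<times> nat list) comp" where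
  "split_active F y B =
     for_each (zip F y)
       (\<lambda>(j, v) (B', F'). charge 4 (if v > 0 then (B' @ [j], F') else (B', F' @ [j])))
       (B, [])"

text \<open>The loop state is \<open>(F\<^bsub>k-1\<^esub>, F\<^sub>k, B\<^sub>k, y)\<close>, where \<open>y\<close> is the last computed vector (the empty
  list before the first iteration), which is indexed by \<open>F\<^bsub>k-1\<^esub>\<close>. The single step at the end of the
  body is the increment of \<open>k\<close>.\<close>

definition active_set_loop ::
  "real list \<Rightarrow> nat list \<times> nat list \<times> nat list \<times> real list \<Rightarrow>
     (nat list \<times> nat list \<times> nat list \<times> real list) comp" where
  "active_set_loop b =
     while_loop
       (\<lambda>(F', F, B, y). charge (length F' + length F) (length F' \<noteq> length F))
       (\<lambda>(F', F, B, y). do {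
          bF \<leftarrow> subvector b F;
          w \<leftarrow> mult_Q_inv bF;
          y' \<leftarrow> negate w;
          (B', F'') \<leftarrow> split_active F y' B;
          charge 1 (F, F'', B', y')
        })"

text \<open>Row \<open>i\<close>, with \<open>N\<close> listing the neighbours of \<open>i\<close>. The diagonal entry \<open>L\<^sub>i\<^sub>i\<close>, initially zero,
  is set to the negative sum of the \<open>x\<^sub>q\<close> by successive subtraction.\<close>

definition active_set_row :: "real mat \<Rightarrow> nat list \<Rightarrow> nat \<Rightarrow> real mat \<Rightarrow> real mat comp" where
  "active_set_row A N i L = do {
     d \<leftarrow> charge (length N) (length N);
     F1 \<leftarrow> charge d [0..<d];
     x0 \<leftarrow> charge d (replicate d 0);
     b \<leftarrow> for_each N (\<lambda>j b. charge 7 (b @ [2 * A $$ (i, i) - 2 * A $$ (i, j)])) [];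
     (F', F, B, y) \<leftarrow> active_set_loop b ([], F1, [], []);
     x \<leftarrow> for_each (zip F y) (\<lambda>(j, v) x. charge 3 (x[j := v])) x0;
     L' \<leftarrow> for_each (zip N x) (\<lambda>(j, v) L. charge 3 (L |\<^sub>m (i, j) \<mapsto> v)) L;
     for_each x (\<lambda>v L. charge 4 (L |\<^sub>m (i, i) \<mapsto> (L $$ (i, i) - v))) L'
   }"

definition rowwise_active_set :: "nat \<Rightarrow> real mat \<Rightarrow> (nat \<Rightarrow> nat list) \<Rightarrow> real mat comp" where
  "rowwise_active_set n A N =
     for_each [0..<n] (\<lambda>i L. active_set_row A (N i) i L) (0\<^sub>m n n)"

end

theory Submission
  imports Defs
begin

text \<open>In row \<open>i\<close> the neighbour entries \<open>x\<close> of a feasible matrix satisfy \<open>x \<le> 0\<close>, and the diagonal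
  entry is \<open>- (\<Sum>q. x\<^sub>q)\<close>. If \<open>c\<^sub>F\<close> is the sum of \<open>b\<^sub>F\<close> divided by \<open>1 + |F|\<close>, then
  \<open>- Q\<^sup>-\<^sup>1 b\<^sub>F\<close> has the entries \<open>(c\<^sub>F - b\<^sub>j) / 2\<close>, so the algorithm discards the \<open>j\<close> with \<open>b\<^sub>j < c\<^sub>F\<close>.
  This can only increase \<open>c\<^sub>F\<close>, hence discarded indices never have to return, and the final vector
  is \<open>x\<^sub>j = min 0 ((c - b\<^sub>j) / 2)\<close> with \<open>c = - 2 (\<Sum>q. x\<^sub>q)\<close>. These are the optimality conditions
  of the convex row problem. All iterations but the last discard an index, so there are at most
  \<open>d\<^sub>i + 1\<close> of them, each taking \<open>O(d\<^sub>i)\<close> steps.\<close>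

section \<open>Optimality of a row\<close>

text \<open>These are the Karush-Kuhn-Tucker conditions of the row problem, with \<open>a\<close>
  the row of \<open>A\<close> and \<open>S\<close> the neighbours. The multiplier of the zero-sum
  constraint is eliminated: stationarity at the diagonal, which carries no active sign constraint,
  identifies it with \<open>r i - a i\<close>.\<close>

definition optimal_row :: "nat \<Rightarrow> nat set \<Rightarrow> nat \<Rightarrow> (nat \<Rightarrow> real) \<Rightarrow> (nat \<Rightarrow> real) \<Rightarrow> bool" where
  "optimal_row n S i a r \<longleftrightarrow>
     (\<Sum>j<n. r j) = 0 \<and>
     (\<forall>j<n. j \<noteq> i \<longrightarrow> j \<notin> S \<longrightarrow> r j = 0) \<and>
     (\<forall>j\<in>S. r j = min 0 (a j + r i - a i))"

lemma optimal_row_cong: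
  assumes "i < n" "S \<subseteq> {..<n}" "\<And>j. j < n \<Longrightarrow> r j = r' j"
  shows "optimal_row n S i a r \<longleftrightarrow> optimal_row n S i a r'"
  unfolding optimal_row_def
  using assms by (intro arg_cong2[of _ _ _ _ "(\<and>)"] ball_cong refl) auto

text \<open>Recovers the sign constraint on the diagonal: the other entries are nonpositive and the
  row sums to zero.\<close>

lemma optimal_row_diag_nonneg:
  assumes "optimal_row n S i a r" "i < n"
  shows "r i \<ge> 0"
proof -
  have "(\<Sum>j<n. r j) = r i + (\<Sum>j\<in>{..<n} - {i}. r j)"
    using assms(2) by (simp add: sum.remove)
  moreover have "(\<Sum>j\<in>{..<n} - {i}. r j) \<le> 0"
    using assms(1) by (intro sum_nonpos) (auto simp: optimal_row_def)
  ultimately show ?thesis using assms(1) by (simp add: optimal_row_def)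
qed

text \<open>Expand the square around \<open>r\<close>. Since \<open>m\<close> and \<open>r\<close>
  both sum to zero, the constant \<open>r i - a i\<close> may be subtracted from the gradient
  \<open>r j - a j\<close>, after which every term of the inner product with \<open>m - r\<close> is
  nonnegative.\<close>

lemma optimal_row_minimal:
  assumes opt: "optimal_row n S i a r"
    and m: "(\<Sum>j<n. m j) = 0" "\<And>j. j < n \<Longrightarrow> j \<noteq> i \<Longrightarrow> j \<notin> S \<Longrightarrow> m j = 0"
      "\<And>j. j < n \<Longrightarrow> j \<in> S \<Longrightarrow> m j \<le> 0"
  shows "(\<Sum>j<n. (a j - r j)\<^sup>2) \<le> (\<Sum>j<n. (a j - m j)\<^sup>2)"
proof -
  have term_nonneg: "0 \<le> (r j - a j - (r i - a i)) * (m j - r j)" if "j < n" for j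
  proof (cases "j \<in> S")
    case True
    then have "r j = min 0 (a j + r i - a i)" "m j \<le> 0"
      using opt m(3) that by (auto simp: optimal_row_def)
    \<comment> \<open>Complementary slackness: if \<open>r j < 0\<close> the first factor vanishes;
      if \<open>r j = 0\<close> both factors are nonpositive.\<close>
    then show ?thesis by (auto simp: min_def intro: mult_nonpos_nonpos)
  next
    case False
    then show ?thesis using opt m(2) that by (cases "j = i") (auto simp: optimal_row_def)
  qed
  have "(\<Sum>j<n. (a j - m j)\<^sup>2) - (\<Sum>j<n. (a j - r j)\<^sup>2)
      = (\<Sum>j<n. (m j - r j)\<^sup>2 + 2 * ((r j - a j - (r i - a i)) * (m j - r j))
          + 2 * (r i - a i) * (m j - r j))"
    unfolding sum_subtractf[symmetric]
    by (rule sum.cong) (auto simp: power2_eq_square algebra_simps)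
  also have "\<dots> = (\<Sum>j<n. (m j - r j)\<^sup>2 + 2 * ((r j - a j - (r i - a i)) * (m j - r j)))"
    using opt m(1)
    by (simp add: sum.distrib sum_subtractf flip: sum_distrib_left)
       (simp add: optimal_row_def)
  also have "\<dots> \<ge> 0"
    using term_nonneg by (intro sum_nonneg) auto
  finally show ?thesis by simp
qed

lemma mult_ones_vec_eq_0_iff:
  fixes L :: "'a :: semiring_1 mat"
  assumes "L \<in> carrier_mat n n"
  shows "L *\<^sub>v vec n (\<lambda>_. 1) = 0\<^sub>v n \<longleftrightarrow> (\<forall>i<n. (\<Sum>j<n. L $$ (i, j)) = 0)"
  using assms by (auto simp: vec_eq_iff scalar_prod_def lessThan_atLeast0)

text \<open>The objective and the constraints both split over the rows, so rowwise optimality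
  suffices.\<close>

lemma optimal_rows_arg_min:
  assumes E: "simple_digraph n E" and A: "A \<in> carrier_mat n n" and L: "L \<in> carrier_mat n n"
    and opt: "\<And>i. i < n \<Longrightarrow>
      optimal_row n (neighbors E i) i (\<lambda>j. A $$ (i, j)) (\<lambda>j. L $$ (i, j))"
  shows "is_arg_min (\<lambda>L. (frobenius_norm (A - L))\<^sup>2) (\<lambda>L. L \<in> L_sd n E) L"
proof -
  have frob: "(frobenius_norm (A - M))\<^sup>2 = (\<Sum>i<n. \<Sum>j<n. (A $$ (i, j) - M $$ (i, j))\<^sup>2)"
    if "M \<in> carrier_mat n n" for M
    using that A by (simp add: frobenius_norm_def sum_nonneg)
  have "L \<in> L_sd n E"
    using L opt optimal_row_diag_nonneg[OF opt] E
    by (auto simp: L_sd_def mult_ones_vec_eq_0_iff optimal_row_def neighbors_def simple_digraph_def)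
  moreover have "(frobenius_norm (A - L))\<^sup>2 \<le> (frobenius_norm (A - M))\<^sup>2"
    if M: "M \<in> L_sd n E" for M
  proof -
    have "M \<in> carrier_mat n n" using M by (simp add: L_sd_def)
    then show ?thesis
      unfolding frob[OF L] frob[OF \<open>M \<in> carrier_mat n n\<close>]
      using M
      by (intro sum_mono optimal_row_minimal[OF opt])
         (auto simp: L_sd_def mult_ones_vec_eq_0_iff neighbors_def)
  qed
  ultimately show ?thesis by (auto simp: is_arg_min_def not_less)
qed


section \<open>The active set loop\<close>

lemma for_each_charge:
  "for_each xs (\<lambda>a s. charge k (g a s)) s = Some (fold g xs s, k * length xs)"
  by (induction xs arbitrary: s) (auto simp: charge_def bind_comp_def)

lemma for_each_map_append:
  "for_each v (\<lambda>a w. charge k (w @ [f a])) [] = Some (map f v, k * length v)"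
  by (simp add: for_each_append)

text \<open>This is \<open>c_F\<close> from the overview. It is twice the diagonal entry that the
  candidate vector on \<open>F\<close> would produce.\<close>

definition threshold :: "real list \<Rightarrow> nat list \<Rightarrow> real" where
  "threshold b F = (\<Sum>j\<leftarrow>F. b ! j) / (1 + real (length F))"

lemma mult_Q_inv_eq:
  "mult_Q_inv (map ((!) b) F) =
     Some (map (\<lambda>j. (b ! j - threshold b F) / 2) F, 7 * length F + 2)"
  by (simp add: mult_Q_inv_def for_each_sum for_each_append charge_bind Some_bind threshold_def)

lemma split_active_eq:
  "split_active F (map h F) B =
     Some ((B @ filter (\<lambda>j. h j > 0) F, filter (\<lambda>j. \<not> h j > 0) F), 4 * length F)"
proof -
  have "for_each (zip F (map h F))
       (\<lambda>(j, v) (B', F'). charge 4 (if v > 0 then (B' @ [j], F') else (B', F' @ [j])))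
       (B, G) = Some ((B @ filter (\<lambda>j. h j > 0) F, G @ filter (\<lambda>j. \<not> h j > 0) F), 4 * length F)"
    for G
    by (induction F arbitrary: B G) (auto simp: charge_def bind_comp_def)
  then show ?thesis by (simp add: split_active_def)
qed

text \<open>By definition of \<open>c = threshold b F\<close>, the sum of \<open>b ! j - c\<close>
  over \<open>F\<close> equals \<open>c\<close>. Only negative summands are dropped, so the sum over
  the remaining indices is at least \<open>c\<close>, which rearranges to the claim.\<close>

lemma threshold_filter_mono:
  "threshold b F \<le> threshold b (filter (\<lambda>j. threshold b F \<le> b ! j) F)"
proof -
  define c where "c = threshold b F"
  define G where "G = filter (\<lambda>j. c \<le> b ! j) F"
  have "(\<Sum>j\<leftarrow>F. b ! j) - c * length F \<le> (\<Sum>j\<leftarrow>G. b ! j) - c * length G"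
    unfolding G_def by (induction F) (auto simp: algebra_simps)
  moreover have "(\<Sum>j\<leftarrow>F. b ! j) = c * (1 + real (length F))"
    by (simp add: c_def threshold_def)
  ultimately have "c * (1 + real (length G)) \<le> (\<Sum>j\<leftarrow>G. b ! j)"
    by (simp add: algebra_simps)
  then have "c \<le> threshold b G"
    by (simp add: threshold_def pos_le_divide_eq)
  then show ?thesis by (simp add: c_def G_def)
qed

lemma active_set_loop_unfold:
  "active_set_loop b (F', F, B, y) =
     (if length F' = length F then Some ((F', F, B, y), length F' + length F)
      else map_option (\<lambda>(s, t). (s, length F' + 18 * length F + 3 + t))
        (active_set_loop b
          (F, filter (\<lambda>j. threshold b F \<le> b ! j) F, B @ filter (\<lambda>j. b ! j < threshold b F) F,
           map (\<lambda>j. (threshold b F - b ! j) / 2) F)))"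
proof -
  define g :: "nat list \<times> nat list \<times> nat list \<times> real list \<Rightarrow> bool comp"
    where "g = (\<lambda>(F', F, B, y). charge (length F' + length F) (length F' \<noteq> length F))"
  define f :: "nat list \<times> nat list \<times> nat list \<times> real list \<Rightarrow> _ comp"
    where "f = (\<lambda>(F', F, B, y). do {
      bF \<leftarrow> subvector b F;
      w \<leftarrow> mult_Q_inv bF;
      y' \<leftarrow> negate w;
      (B', F'') \<leftarrow> split_active F y' B;
      charge 1 (F, F'', B', y')
    })"
  have y: "negate (map (\<lambda>j. (b ! j - threshold b F) / 2) F) =
      Some (map (\<lambda>j. (threshold b F - b ! j) / 2) F, 3 * length F)"
    by (simp add: negate_def for_each_map_append field_simps)
  \<comment> \<open>Per index: 3 for the subvector, 7 for the product with \<open>Q_inv\<close>, 3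
    for the negation, 4 for the split. The constant is 2 from \<open>mult_Q_inv\<close> plus 1 for
    incrementing \<open>k\<close>.\<close>
  have "f (F', F, B, y) =
      Some ((F, filter (\<lambda>j. threshold b F \<le> b ! j) F, B @ filter (\<lambda>j. b ! j < threshold b F) F,
             map (\<lambda>j. (threshold b F - b ! j) / 2) F), 17 * length F + 3)"
    by (simp add: f_def subvector_def for_each_map_append mult_Q_inv_eq y Some_bind
        split_active_eq not_less charge_def[of "Suc 0"])
  moreover have "active_set_loop b = while_loop g f"
    unfolding active_set_loop_def g_def f_def ..
  moreover have "g (F', F, B, y) = Some (length F' \<noteq> length F, length F' + length F)"
    by (simp add: g_def charge_def)
  ultimately show ?thesis
    by (simp add: while_loop.simps[of g f "(F', F, B, y)"] Some_bind
        charge_def[of 0] option.map_comp comp_def case_prod_unfold add.assoc)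
qed

text \<open>The last conjunct bounds the time; \<open>D\<close> stands for the initial size of the index set.\<close>

lemma active_set_loop_correct:
  assumes "length F' \<noteq> length F" "length F \<le> D"
  shows "\<exists>G B' t. active_set_loop b (F', F, B, y) =
      Some ((G, G, B', map (\<lambda>j. (threshold b G - b ! j) / 2) G), t) \<and>
    threshold b F \<le> threshold b G \<and> G = filter (\<lambda>j. threshold b G \<le> b ! j) F \<and>
    t \<le> length F' + (length F + 1) * (20 * D + 3)"
  \<comment> \<open>The size of \<open>F\<close> is the termination measure: an iteration that does
    not lead to the exit shrinks it strictly.\<close>
  using assms
proof (induction "length F" arbitrary: F F' B y rule: less_induct)
  case less
  define c where "c = threshold b F"
  define F2 where "F2 = filter (\<lambda>j. c \<le> b ! j) F"
  define B2 where "B2 = B @ filter (\<lambda>j. b ! j < c) F"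
  define y2 where "y2 = map (\<lambda>j. (c - b ! j) / 2) F"
  have step: "active_set_loop b (F', F, B, y) =
      map_option (\<lambda>(s, t). (s, length F' + 18 * length F + 3 + t))
        (active_set_loop b (F, F2, B2, y2))"
    using less.prems by (simp add: active_set_loop_unfold[of b F'] F2_def B2_def y2_def c_def)
  show ?case
  proof (cases "length F = length F2")
    case True
    then have "c \<le> b ! j" if "j \<in> set F" for j
      using length_filter_less[OF that, of "\<lambda>j. c \<le> b ! j"] by (auto simp: F2_def)
    then have "F2 = F"
      by (simp add: F2_def filter_id_conv)
    moreover have "active_set_loop b (F, F2, B2, y2) = Some ((F, F2, B2, y2), length F + length F2)"
      using True by (simp add: active_set_loop_unfold[of b F])
    ultimately have "active_set_loop b (F', F, B, y) =
        Some ((F, F, B2, map (\<lambda>j. (threshold b F - b ! j) / 2) F), length F' + 20 * length F + 3)"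
      using step by (simp add: y2_def c_def)
    moreover have "F = filter (\<lambda>j. threshold b F \<le> b ! j) F"
      using \<open>F2 = F\<close> by (simp add: F2_def c_def)
    \<comment> \<open>The 18 of this iteration is raised to 20 by the final guard test, which visits
      \<open>F\<close> twice.\<close>
    moreover have "20 * length F + 3 \<le> (length F + 1) * (20 * D + 3)"
      using less.prems(2) by (simp add: trans_le_add1)
    ultimately show ?thesis by fastforce
  next
    case False
    then have less2: "length F2 < length F"
      using length_filter_le[of "\<lambda>j. c \<le> b ! j" F] unfolding F2_def by linarith
    with less.prems obtain G B' t where G:
      "active_set_loop b (F, F2, B2, y2) =
        Some ((G, G, B', map (\<lambda>j. (threshold b G - b ! j) / 2) G), t)"
      "threshold b F2 \<le> threshold b G" "G = filter (\<lambda>j. threshold b G \<le> b ! j) F2"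
      "t \<le> length F + (length F2 + 1) * (20 * D + 3)"
      using less.hyps[of F2 F B2 y2] by auto
    have "c \<le> threshold b G"
      using threshold_filter_mono[of b F] G(2) by (simp add: c_def F2_def)
    \<comment> \<open>Filtering in stages agrees with filtering once by the final, larger threshold:
      a discarded index never has to return.\<close>
    have "filter (\<lambda>j. e \<le> b ! j) F2 = filter (\<lambda>j. e \<le> b ! j) F" if "c \<le> e" for e
      using that unfolding F2_def filter_filter by (intro filter_cong) auto
    from trans[OF G(3) this[OF \<open>c \<le> threshold b G\<close>]]
    have filter: "G = filter (\<lambda>j. threshold b G \<le> b ! j) F" .
    have "active_set_loop b (F', F, B, y) =
        Some ((G, G, B', map (\<lambda>j. (threshold b G - b ! j) / 2) G), length F' + 18 * length F + 3 + t)"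
      using step G(1) by simp
    moreover have "length F' + 18 * length F + 3 + t \<le> length F' + (length F + 1) * (20 * D + 3)"
    proof -
      \<comment> \<open>A discarded index pays for this iteration: its share
        \<open>20 * D + 3\<close> covers \<open>19 * length F + 3\<close>, that is, 18 per index
        here and one more from the next guard.\<close>
      have "(length F2 + 1) * (20 * D + 3) \<le> length F * (20 * D + 3)"
        using less2 by (intro mult_right_mono) auto
      with G(4) less.prems(2) show ?thesis by simp
    qed
    ultimately show ?thesis
      using filter \<open>c \<le> threshold b G\<close> unfolding c_def by blast
  qed
qed

text \<open>Summands outside \<open>G\<close> vanish, and on \<open>G\<close> the definition of
  \<open>threshold\<close> gives the sum of \<open>b\<close>. Hence the diagonal entry produced by
  the final vector is half the threshold, the value that the optimality conditions demand.\<close>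

lemma sum_list_threshold:
  assumes "G = filter (\<lambda>j. threshold b G \<le> b ! j) [0..<length b]"
  shows "(\<Sum>v\<leftarrow>b. min 0 ((threshold b G - v) / 2)) = - threshold b G / 2"
proof -
  define c where "c = threshold b G"
  have "(\<Sum>v\<leftarrow>b. min 0 ((c - v) / 2)) = (\<Sum>j\<leftarrow>[0..<length b]. min 0 ((c - b ! j) / 2))"
    by (intro arg_cong[where f = sum_list] nth_equalityI) simp_all
  also have "\<dots> = (\<Sum>j\<leftarrow>filter (\<lambda>j. c \<le> b ! j) [0..<length b]. (c - b ! j) / 2)"
    unfolding sum_list_map_filter' by (intro arg_cong[where f = sum_list] map_cong) auto
  also have "\<dots> = (\<Sum>j\<leftarrow>G. (c - b ! j) / 2)"
    using assms by (simp add: c_def)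
  also have "\<dots> = (c * length G - (\<Sum>j\<leftarrow>G. b ! j)) / 2"
    by (induction G) (auto simp: field_simps)
  also have "(\<Sum>j\<leftarrow>G. b ! j) = c * (1 + real (length G))"
    by (simp add: c_def threshold_def)
  finally show ?thesis by (simp add: c_def field_simps)
qed

lemma active_set_loop_init:
  "\<exists>G B t. active_set_loop b ([], [0..<length b], [], []) =
      Some ((G, G, B, map (\<lambda>j. (threshold b G - b ! j) / 2) G), t) \<and>
    G = filter (\<lambda>j. threshold b G \<le> b ! j) [0..<length b] \<and> t \<le> 46 * (length b)\<^sup>2"
\<comment> \<open>For a row without neighbours the two initial index sets have equal size, so the
  body never runs and the guard costs nothing.\<close>
proof (cases "b = []")
  case True
  then show ?thesis by (simp add: active_set_loop_unfold)
next
  case False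
  \<comment> \<open>Lower-order terms are absorbed using \<open>d > 0\<close>: 46 = 20 + 23 +
    3.\<close>
  have "(d + 1) * (20 * d + 3) \<le> 46 * d\<^sup>2" if "d > 0" for d :: nat
  proof -
    have "d \<le> d * d" "1 \<le> d * d"
      using that by auto
    moreover have "(d + 1) * (20 * d + 3) = 20 * (d * d) + 23 * d + 3"
      by (simp add: algebra_simps)
    ultimately show ?thesis unfolding power2_eq_square by linarith
  qed
  from this[of "length b"] False
  have "length ([] :: nat list) + (length [0..<length b] + 1) * (20 * length b + 3) \<le> 46 * (length b)\<^sup>2"
    by simp
  moreover have "length ([] :: nat list) \<noteq> length [0..<length b]" "length [0..<length b] \<le> length b"
    using False by simp_all
  from active_set_loop_correct[OF this, of b "[]" "[]"]
  obtain G B t where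
    "active_set_loop b ([], [0..<length b], [], []) =
      Some ((G, G, B, map (\<lambda>j. (threshold b G - b ! j) / 2) G), t)"
    "G = filter (\<lambda>j. threshold b G \<le> b ! j) [0..<length b]"
    "t \<le> length ([] :: nat list) + (length [0..<length b] + 1) * (20 * length b + 3)"
    by blast
  ultimately show ?thesis
    by (meson order_trans)
qed

section \<open>Processing the rows\<close>

lemma fold_list_update:
  "fold (\<lambda>(j, v) x. x[j := v]) (zip F (map h F)) x =
     map (\<lambda>q. if q \<in> set F then h q else x ! q) [0..<length x]"
  by (induction F arbitrary: x) (auto intro!: nth_equalityI)

lemma fold_update_mat_row:
  assumes "L \<in> carrier_mat m n" "i < m" "set N \<subseteq> {..<n}"
  shows "fold (\<lambda>(j, v) L. L |\<^sub>m (i, j) \<mapsto> v) (zip N (map h N)) L =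
     mat m n (\<lambda>(k, j). if k = i \<and> j \<in> set N then h j else L $$ (k, j))"
  using assms
proof (induction N arbitrary: L)
  case (Cons a N)
  then have "L |\<^sub>m (i, a) \<mapsto> h a \<in> carrier_mat m n" by auto
  from Cons.IH[OF this] Cons.prems show ?case
    by (auto intro!: eq_matI)
qed auto

lemma fold_update_mat_subtract:
  fixes L :: "'a :: ab_group_add mat"
  assumes "L \<in> carrier_mat m n" "i < m" "j < n"
  shows "fold (\<lambda>v L. L |\<^sub>m (i, j) \<mapsto> (L $$ (i, j) - v)) x L =
     L |\<^sub>m (i, j) \<mapsto> (L $$ (i, j) - sum_list x)"
  using assms
proof (induction x arbitrary: L)
  case (Cons a x)
  then have "L |\<^sub>m (i, j) \<mapsto> (L $$ (i, j) - a) \<in> carrier_mat m n" by auto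
  from Cons.IH[OF this] Cons.prems show ?case
    by (auto simp: update_mat_def algebra_simps)
qed (auto simp: update_mat_def)

text \<open>The zero row at the start supplies the entries off the neighbours and the initial value
  of the diagonal subtraction. That other rows stay unchanged is what the induction over the rows
  needs.\<close>

lemma active_set_row_correct:
  assumes L: "L \<in> carrier_mat n n" and i: "i < n" "\<And>j. j < n \<Longrightarrow> L $$ (i, j) = 0"
    and N: "distinct N" "set N \<subseteq> {..<n}" "i \<notin> set N"
  shows "\<exists>L' t. active_set_row A N i L = Some (L', t) \<and> L' \<in> carrier_mat n n \<and>
    (\<forall>k<n. \<forall>j<n. k \<noteq> i \<longrightarrow> L' $$ (k, j) = L $$ (k, j)) \<and>
    optimal_row n (set N) i (\<lambda>j. A $$ (i, j)) (\<lambda>j. L' $$ (i, j)) \<and>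
    t \<le> 66 * (length N)\<^sup>2"
proof -
  define b where "b = map (\<lambda>j. 2 * A $$ (i, i) - 2 * A $$ (i, j)) N"
  obtain G B t where loop: "active_set_loop b ([], [0..<length N], [], []) =
      Some ((G, G, B, map (\<lambda>j. (threshold b G - b ! j) / 2) G), t)"
    and G: "G = filter (\<lambda>j. threshold b G \<le> b ! j) [0..<length b]"
    and t: "t \<le> 46 * (length N)\<^sup>2"
    using active_set_loop_init[of b] by (auto simp: b_def)
  define c where "c = threshold b G"
  \<comment> \<open>With \<open>b\<close> as computed from \<open>A\<close>,
    \<open>(c - b ! q) / 2\<close> is the unclipped expression here, and \<open>c / 2\<close> is the
    final diagonal entry; so \<open>h\<close> has the form required by
    \<open>optimal_row\<close>.\<close>
  define h where "h = (\<lambda>j. min 0 (A $$ (i, j) + c / 2 - A $$ (i, i)))"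
  have set_G: "set G = {j. j < length N \<and> c \<le> b ! j}"
    by (subst G) (auto simp: c_def b_def)
  \<comment> \<open>Outside \<open>G\<close> the minimum is 0, which is the initial value left in
    place in \<open>x0\<close>.\<close>
  have x: "map h N = map (\<lambda>q. if q \<in> set G then (c - b ! q) / 2 else replicate (length N) 0 ! q)
      [0..<length N]"
    by (rule nth_equalityI) (auto simp: h_def set_G b_def min_def field_simps)
  have "map h N = map (\<lambda>v. min 0 ((c - v) / 2)) b"
    by (simp add: h_def b_def field_simps)
  then have sum_x: "sum_list (map h N) = - c / 2"
    using sum_list_threshold[OF G] by (simp add: c_def)
  define L1 where "L1 = mat n n (\<lambda>(k, j). if k = i \<and> j \<in> set N then h j else L $$ (k, j))"
  define L2 where "L2 = L1 |\<^sub>m (i, i) \<mapsto> c / 2"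
  have L1: "L1 \<in> carrier_mat n n" "L1 $$ (i, i) = 0"
    using i N by (auto simp: L1_def)
  have b: "for_each N (\<lambda>j b. charge 7 (b @ [2 * A $$ (i, i) - 2 * A $$ (i, j)])) [] =
      Some (b, 7 * length N)"
    by (simp add: for_each_map_append b_def)
  have "for_each (zip G (map (\<lambda>j. (c - b ! j) / 2) G)) (\<lambda>(j, v) x. charge 3 (x[j := v]))
      (replicate (length N) 0) = Some (map h N, 3 * length G)"
    using fold_list_update[of G "\<lambda>j. (c - b ! j) / 2" "replicate (length N) 0"]
    by (simp add: for_each_charge x case_prod_unfold)
  moreover have "for_each (zip N (map h N)) (\<lambda>(j, v) L. charge 3 (L |\<^sub>m (i, j) \<mapsto> v)) L =
      Some (L1, 3 * length N)"
    using fold_update_mat_row[OF L i(1) N(2), of h]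
    by (simp add: for_each_charge L1_def case_prod_unfold)
  moreover have "for_each (map h N) (\<lambda>v L. charge 4 (L |\<^sub>m (i, i) \<mapsto> (L $$ (i, i) - v))) L1 =
      Some (L2, 4 * length N)"
    unfolding for_each_charge fold_update_mat_subtract[OF L1(1) i(1) i(1)]
    by (simp add: L2_def L1(2) sum_x)
  ultimately have "active_set_row A N i L = Some (L2, 17 * length N + t + 3 * length G)"
    by (simp add: active_set_row_def b loop charge_bind Some_bind flip: c_def)
  \<comment> \<open>66 = 17 + 46 + 3. The 17 consists of 3 for the set-up of \<open>d\<close>,
    \<open>F1\<close> and \<open>x0\<close>, 7 for \<open>b\<close>, 3 for writing the row and 4 for
    the diagonal.\<close>
  moreover have "17 * length N + t + 3 * length G \<le> 66 * (length N)\<^sup>2"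
  proof -
    have "length G \<le> length N"
      by (subst G) (metis b_def diff_zero length_filter_le length_map length_upt)
    with t show ?thesis
      using le_square[of "length N"] unfolding power2_eq_square by linarith
  qed
  moreover have "L2 \<in> carrier_mat n n"
    using L1 by (simp add: L2_def update_mat_def)
  moreover have "\<forall>k<n. \<forall>j<n. k \<noteq> i \<longrightarrow> L2 $$ (k, j) = L $$ (k, j)"
    using L1 by (simp add: L2_def) (simp add: L1_def)
  moreover have "optimal_row n (set N) i (\<lambda>j. A $$ (i, j)) (\<lambda>j. L2 $$ (i, j))"
  proof -
    have row: "L2 $$ (i, j) = (if j = i then c / 2 else if j \<in> set N then h j else 0)" if "j < n" for j
      using that i L1 by (simp add: L2_def) (simp add: L1_def)
    have "(\<Sum>j<n. L2 $$ (i, j)) = c / 2 + (\<Sum>j\<in>{..<n} - {i}. if j \<in> set N then h j else 0)"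
      using i by (simp add: sum.remove row)
    also have "(\<Sum>j\<in>{..<n} - {i}. if j \<in> set N then h j else 0) = sum h (set N)"
      using N by (intro sum.mono_neutral_cong_right) auto
    also have "\<dots> = - c / 2"
      using sum_x N(1) by (simp add: sum.distinct_set_conv_list)
    finally show ?thesis
      using i N(2,3) by (auto simp: optimal_row_def row h_def subset_iff)
  qed
  ultimately show ?thesis by blast
qed

text \<open>Generalised to any list of rows and any matrix that is still zero there. As rows do not
  interfere, pending rows remain zero and finished rows remain optimal.\<close>

lemma rowwise_active_set_correct:
  assumes "L \<in> carrier_mat n n" "distinct I" "set I \<subseteq> {..<n}"
    and "\<And>i j. i \<in> set I \<Longrightarrow> j < n \<Longrightarrow> L $$ (i, j) = 0"
    and "\<And>i. i \<in> set I \<Longrightarrow> distinct (N i) \<and> set (N i) \<subseteq> {..<n} \<and> i \<notin> set (N i)"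
  shows "\<exists>L' t. for_each I (\<lambda>i L. active_set_row A (N i) i L) L = Some (L', t) \<and>
    L' \<in> carrier_mat n n \<and>
    (\<forall>k<n. \<forall>j<n. k \<notin> set I \<longrightarrow> L' $$ (k, j) = L $$ (k, j)) \<and>
    (\<forall>i\<in>set I. optimal_row n (set (N i)) i (\<lambda>j. A $$ (i, j)) (\<lambda>j. L' $$ (i, j))) \<and>
    t \<le> 66 * (\<Sum>i\<in>set I. (length (N i))\<^sup>2)"
  using assms
proof (induction I arbitrary: L)
  case Nil
  then show ?case by (simp add: charge_def)
next
  case (Cons i I)
  obtain L1 t1 where L1: "active_set_row A (N i) i L = Some (L1, t1)" "L1 \<in> carrier_mat n n"
    "\<And>k j. k < n \<Longrightarrow> j < n \<Longrightarrow> k \<noteq> i \<Longrightarrow> L1 $$ (k, j) = L $$ (k, j)"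
    "optimal_row n (set (N i)) i (\<lambda>j. A $$ (i, j)) (\<lambda>j. L1 $$ (i, j))"
    "t1 \<le> 66 * (length (N i))\<^sup>2"
    using active_set_row_correct[of L n i "N i" A] Cons.prems by fastforce
  have "L1 $$ (k, j) = 0" if "k \<in> set I" "j < n" for k j
  proof -
    have "k < n" "k \<noteq> i" using that Cons.prems(2,3) by auto
    then show ?thesis using that L1(3)[of k j] Cons.prems(4)[of k j] by simp
  qed
  then obtain L2 t2 where L2: "for_each I (\<lambda>i L. active_set_row A (N i) i L) L1 = Some (L2, t2)"
    "L2 \<in> carrier_mat n n"
    "\<And>k j. k < n \<Longrightarrow> j < n \<Longrightarrow> k \<notin> set I \<Longrightarrow> L2 $$ (k, j) = L1 $$ (k, j)"
    "\<And>i. i \<in> set I \<Longrightarrow> optimal_row n (set (N i)) i (\<lambda>j. A $$ (i, j)) (\<lambda>j. L2 $$ (i, j))"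
    "t2 \<le> 66 * (\<Sum>i\<in>set I. (length (N i))\<^sup>2)"
    using Cons.IH[OF L1(2)] Cons.prems by auto
  \<comment> \<open>Distinctness of the list keeps the later iterations away from row
    \<open>i\<close>.\<close>
  have "optimal_row n (set (N i)) i (\<lambda>j. A $$ (i, j)) (\<lambda>j. L2 $$ (i, j))"
    using L1(4) L2(3)[of i] Cons.prems(2,3,5)
      optimal_row_cong[of i n "set (N i)" "\<lambda>j. L2 $$ (i, j)" "\<lambda>j. L1 $$ (i, j)"]
    by simp
  moreover have "for_each (i # I) (\<lambda>i L. active_set_row A (N i) i L) L = Some (L2, t1 + t2)"
    using L1(1) L2(1) by (simp add: Some_bind)
  moreover have "L2 $$ (k, j) = L $$ (k, j)" if "k < n" "j < n" "k \<notin> set (i # I)" for k j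
    using that L1(3)[of k j] L2(3)[of k j] by simp
  moreover have "t1 + t2 \<le> 66 * (\<Sum>i\<in>set (i # I). (length (N i))\<^sup>2)"
    using L1(5) L2(5) Cons.prems(2) by simp
  moreover have "\<forall>i\<in>set (i # I). optimal_row n (set (N i)) i (\<lambda>j. A $$ (i, j)) (\<lambda>j. L2 $$ (i, j))"
    using calculation(1) L2(4) by (metis set_ConsD)
  ultimately show ?case
    using L2(2) by (intro exI[of _ L2] exI[of _ "t1 + t2"] conjI) blast+
qed

theorem corollary3p7:
  shows "\<exists>C::real. \<forall>(n::nat) (E::(nat \<times> nat) set) (A::real mat) (N::nat \<Rightarrow> nat list).
    simple_digraph n E \<longrightarrow>
    A \<in> carrier_mat n n \<longrightarrow>
    (\<forall>i<n. distinct (N i) \<and> set (N i) = neighbors E i) \<longrightarrow>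
    (\<exists>Lopt t. rowwise_active_set n A N = Some (Lopt, t) \<and>
       is_arg_min (\<lambda>L. (frobenius_norm (A - L))\<^sup>2) (\<lambda>L. L \<in> L_sd n E) Lopt \<and>
       real t \<le> C * (\<Sum>i<n. (real (card (neighbors E i)))\<^sup>2))"
\<comment> \<open>The constant per row serves for the whole run, because the loop over the rows adds
  no charge of its own.\<close>
proof (intro exI[of _ 66] allI impI)
  fix n :: nat and E :: "(nat \<times> nat) set" and A :: "real mat" and N :: "nat \<Rightarrow> nat list"
  assume E: "simple_digraph n E" and A: "A \<in> carrier_mat n n"
    and N: "\<forall>i<n. distinct (N i) \<and> set (N i) = neighbors E i"
  have "set (N i) \<subseteq> {..<n} \<and> i \<notin> set (N i)" if "i < n" for i
    using that N E by (auto simp: neighbors_def simple_digraph_def)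
  then have "\<exists>L t. for_each [0..<n] (\<lambda>i L. active_set_row A (N i) i L) (0\<^sub>m n n) = Some (L, t) \<and>
    L \<in> carrier_mat n n \<and>
    (\<forall>k<n. \<forall>j<n. k \<notin> set [0..<n] \<longrightarrow> L $$ (k, j) = 0\<^sub>m n n $$ (k, j)) \<and>
    (\<forall>i\<in>set [0..<n]. optimal_row n (set (N i)) i (\<lambda>j. A $$ (i, j)) (\<lambda>j. L $$ (i, j))) \<and>
    t \<le> 66 * (\<Sum>i\<in>set [0..<n]. (length (N i))\<^sup>2)"
    using N by (intro rowwise_active_set_correct) auto
  then obtain L t where L: "rowwise_active_set n A N = Some (L, t)" "L \<in> carrier_mat n n"
    "\<forall>i\<in>set [0..<n]. optimal_row n (set (N i)) i (\<lambda>j. A $$ (i, j)) (\<lambda>j. L $$ (i, j))"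
    "t \<le> 66 * (\<Sum>i\<in>set [0..<n]. (length (N i))\<^sup>2)"
    unfolding rowwise_active_set_def by blast
  have "is_arg_min (\<lambda>L. (frobenius_norm (A - L))\<^sup>2) (\<lambda>L. L \<in> L_sd n E) L"
    using optimal_rows_arg_min[OF E A L(2)] L(3) N by simp
  moreover have "real t \<le> 66 * (\<Sum>i<n. (real (card (neighbors E i)))\<^sup>2)"
  proof -
    have "length (N i) = card (neighbors E i)" if "i < n" for i
      using N that distinct_card[of "N i"] by simp
    then have "(\<Sum>i\<in>set [0..<n]. (length (N i))\<^sup>2) = (\<Sum>i<n. (card (neighbors E i))\<^sup>2)"
      by (intro sum.cong) auto
    with L(4) have "real t \<le> real (66 * (\<Sum>i<n. (card (neighbors E i))\<^sup>2))"
      unfolding of_nat_le_iff by argo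
    then show ?thesis by simp
  qed
  ultimately show "\<exists>Lopt t. rowwise_active_set n A N = Some (Lopt, t) \<and>
       is_arg_min (\<lambda>L. (frobenius_norm (A - L))\<^sup>2) (\<lambda>L. L \<in> L_sd n E) Lopt \<and>
       real t \<le> 66 * (\<Sum>i<n. (real (card (neighbors E i)))\<^sup>2)"
    using L(1) by blast
qed

end
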